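(* Let $\mathcal H$ be a separable reproducing kernel Hilbert space and let $(S_n)_{n\ge1}$ be a sequence of bounded linear test-statistics (random elements of $\mathcal H^\star$). Let $(\lambda_i)_{i\ge1}$ be positive constants, $(\phi_i)_{i\ge1}$ an orthonormal basis of $\mathcal H$, $(Z_i)_{i\ge1}$ i.i.d. standard normal random variables, and define $S(\cdot)=\sum_{i=1}^\infty\sqrt{\lambda_i}Z_i\langle\phi_i,\cdot\rangle_{\mathcal H}$. Suppose that the sum defining $S$ converges almost surely in $\mathcal H^\star$ (i.e. almost surely the truncated sums form a Cauchy sequence in $\mathcal H^\star$). If $S_n\overset{\mathcal D}{\to}S$ in $\mathcal H^\star$ as $n\to\infty$, then the following three conditions hold: ($G_0$) there is a continuous bilinear form $\sigma:\mathcal H\times\mathcal H\to\mathbb R$ such that for every $m\in\mathbb N$ and all $\omega_1,\dots,\omega_m\in\mathcal H$, $S_n(\omega_1+\dots+\omega_m)$ converges in distribution as $n\to\infty$ to a normal random variable with mean $0$ and variance $\sum_{i=1}^m\sum_{j=1}^m\sigma(\omega_i,\omega_j)$; ($G_1$) for this $\sigma$ and some orthonormal basis $(\psi_i)_{i\ge1}$ of $\mathcal H$, $\sum_{i\ge1}\sigma(\psi_i,\psi_i)<\infty$; ($G_2$) for some orthonormal basis $(\psi_i)_{i\ge1}$ of $\mathcal H$ and every $\varepsilon>0$, $\lim_{i\to\infty}\limsup_{n\to\infty}\mathbb P\big(\|S_n\circ P_{V_i^\perp}\|_{\mathcal H\to\mathbb R}^2\ge\varepsilon\big)=0$, where $V_i=\mathrm{span}(\psi_1,\dots,\psi_i)$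 and $P_{V_i^\perp}$ is the orthogonal projection onto $V_i^\perp$.
   Context: $\mathcal H^\star$ is the space of bounded linear functionals on $\mathcal H$ with operator norm $\|\cdot\|_{\mathcal H\to\mathbb R}$. A bounded linear test-statistic is a random variable taking values in $\mathcal H^\star$ (measurable for the Borel $\sigma$-algebra). $\overset{\mathcal D}{\to}$ denotes convergence in distribution (weak convergence of laws on $\mathcal H^\star$ with its norm topology). A degenerate normal with variance $0$ is the point mass at $0$. If $\mathcal H$ is finite-dimensional, bases and sums are finite. *)

theory Defs
  imports "HOL-Probability.Probability"
begin

text \<open>
  A Hilbert space \<^typ>\<open>'h\<close> is regarded as a space of real functions on \<^typ>\<open>'x\<close> through the evaluation
  map \<open>evl f x\<close>: injectivity says that an element is determined by its values, bounded linearity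
  in \<open>f\<close> says that the vector space operations are pointwise and that point evaluations
  are continuous.
\<close>

definition rkhs :: "('h::{real_inner,complete_space} \<Rightarrow> 'x \<Rightarrow> real) \<Rightarrow> bool" where
  "rkhs evl \<longleftrightarrow> inj evl \<and> (\<forall>x. bounded_linear (\<lambda>f. evl f x))"

text \<open>
  Bases are indexed by the natural numbers below an extended natural number \<open>N\<close>, the dimension:
  \<open>N = \<infinity>\<close> gives a sequence, finite \<open>N\<close> a finite family. Indices start at \<open>0\<close>; the values of a
  family at indices \<open>\<ge> N\<close> are irrelevant.
\<close>

definition idx :: "enat \<Rightarrow> nat set" where
  "idx N = {i. enat i < N}"

definition orthonormal_basis :: "enat \<Rightarrow> (nat \<Rightarrow> 'h::real_inner) \<Rightarrow> bool" where
  "orthonormal_basis N e \<longleftrightarrow>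
     (\<forall>i\<in>idx N. \<forall>j\<in>idx N. e i \<bullet> e j = (if i = j then 1 else 0)) \<and>
     closure (span (e ` idx N)) = UNIV"

text \<open>The span of the first \<open>i\<close> basis vectors (of all of them, if \<open>i\<close> exceeds the dimension).\<close>

definition initial_span :: "enat \<Rightarrow> (nat \<Rightarrow> 'h::real_inner) \<Rightarrow> nat \<Rightarrow> 'h set" where
  "initial_span N e i = span (e ` (idx N \<inter> {..<i}))"

text \<open>
  The library's \<^const>\<open>closest_point\<close> is restricted to Heine-Borel spaces. The description below is
  proper (exactly one such \<open>p\<close>) whenever \<open>U\<close> is a closed subspace of a Hilbert space.
\<close>

definition orth_proj :: "'h::real_inner set \<Rightarrow> 'h \<Rightarrow> 'h" where
  "orth_proj U x = (THE p. p \<in> U \<and> (\<forall>u\<in>U. orthogonal (x - p) u))"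

text \<open>
  Weak convergence of Borel measures on an arbitrary topological space; the library's
  \<^const>\<open>weak_conv_m\<close> covers the real line only.
\<close>

definition weak_conv_borel :: "(nat \<Rightarrow> 'a::topological_space measure) \<Rightarrow> 'a measure \<Rightarrow> bool" where
  "weak_conv_borel \<mu> \<nu> \<longleftrightarrow>
     (\<forall>f::'a \<Rightarrow> real. continuous_on UNIV f \<and> bounded (range f) \<longrightarrow>
        (\<lambda>n. \<integral>x. f x \<partial>\<mu> n) \<longlonglongrightarrow> (\<integral>x. f x \<partial>\<nu>))"

text \<open>The centred normal law with variance \<open>v \<ge> 0\<close>; \<^const>\<open>normal_density\<close> takes the standard deviation.\<close>

definition centred_normal :: "real \<Rightarrow> real measure" where
  "centred_normal v =
     (if v = 0 then return borel 0 else density lborel (normal_density 0 (sqrt v)))"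

definition gauss_term ::
  "enat \<Rightarrow> (nat \<Rightarrow> real) \<Rightarrow> (nat \<Rightarrow> 'h::real_inner) \<Rightarrow> (nat \<Rightarrow> 'b \<Rightarrow> real) \<Rightarrow> nat \<Rightarrow> 'b \<Rightarrow> 'h \<Rightarrow>\<^sub>L real"
where
  "gauss_term N lam \<phi> Z i w =
     (if i \<in> idx N then (sqrt (lam i) * Z i w) *\<^sub>R blinfun_inner_right (\<phi> i) else 0)"

text \<open>Where the series diverges (a null set, if it converges almost surely) the value is arbitrary.\<close>

definition gauss_series ::
  "enat \<Rightarrow> (nat \<Rightarrow> real) \<Rightarrow> (nat \<Rightarrow> 'h::real_inner) \<Rightarrow> (nat \<Rightarrow> 'b \<Rightarrow> real) \<Rightarrow> 'b \<Rightarrow> 'h \<Rightarrow>\<^sub>L real"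
where
  "gauss_series N lam \<phi> Z w = (\<Sum>i. gauss_term N lam \<phi> Z i w)"

end

theory Submission
  imports Defs
begin

text \<open>
  Almost sure convergence of \<open>S\<close> in the dual forces \<open>\<Sum>\<lambda>\<^sub>i Z\<^sub>i\<^sup>2 < \<infinity>\<close> almost surely, whose Laplace transform
  then gives \<open>\<Sum>\<lambda>\<^sub>i < \<infinity>\<close>. Hence \<open>\<sigma>(x, y) = \<Sum>\<lambda>\<^sub>i \<langle>\<phi>\<^sub>i, x\<rangle> \<langle>\<phi>\<^sub>i, y\<rangle>\<close> is a continuous bilinear form with trace
  \<open>\<Sum>\<lambda>\<^sub>i\<close>, and \<open>S(h)\<close> has characteristic function \<open>exp (-\<sigma>(h, h) t\<^sup>2 / 2)\<close>; Levy's theorem yields the limit of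
  \<open>S\<^sub>n(h)\<close>. For the tails, composing \<open>S\<close> with the projection leaves \<open>S\<close> minus its \<open>i\<close>-th partial sum,
  which tends to \<open>0\<close>; the probabilities are compared through the bounded continuous function
  \<open>min 1 (\<parallel>T \<circ> P\<parallel>\<^sup>2 / \<epsilon>)\<close>.
\<close>

section \<open>Finite orthonormal families: dual norm and orthogonal projection\<close>

text \<open>Evaluate the functional at its Riesz representative \<open>v\<close>: the value is
  \<open>(norm v)\<^sup>2\<close>, so the operator norm is at least \<open>norm v\<close>. This
  turns bounds on partial sums in the dual into bounds on sums of squared coefficients.\<close>

lemma norm_orthonormal_sum_blinfun_ge:
  fixes \<phi> :: "nat \<Rightarrow> 'h::real_inner"
  assumes fin: "finite I"
    and on: "\<And>i j. i \<in> I \<Longrightarrow> j \<in> I \<Longrightarrow> \<phi> i \<bullet> \<phi> j = (if i = j then 1 else 0)"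
  shows "sqrt (\<Sum>i\<in>I. (a i)\<^sup>2) \<le> norm (\<Sum>i\<in>I. a i *\<^sub>R blinfun_inner_right (\<phi> i))"
proof -
  define v where "v = (\<Sum>i\<in>I. a i *\<^sub>R \<phi> i)"
  define T where "T = (\<Sum>i\<in>I. a i *\<^sub>R blinfun_inner_right (\<phi> i))"
  have inner_v: "\<phi> i \<bullet> v = a i" if "i \<in> I" for i
  proof -
    have "\<phi> i \<bullet> v = (\<Sum>j\<in>I. if i = j then a j else 0)"
      unfolding v_def inner_sum_right using on that by (intro sum.cong) auto
    then show ?thesis using fin that by simp
  qed
  have Tv: "blinfun_apply T v = (\<Sum>i\<in>I. (a i)\<^sup>2)"
    unfolding T_def by (simp add: blinfun.sum_left blinfun.scaleR_left inner_v power2_eq_square)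
  have "v \<bullet> v = (\<Sum>i\<in>I. (a i)\<^sup>2)"
    by (subst (1) v_def) (simp add: inner_sum_left inner_v power2_eq_square)
  then have nv: "norm v = sqrt (\<Sum>i\<in>I. (a i)\<^sup>2)"
    by (simp add: norm_eq_sqrt_inner)
  have "(norm v)\<^sup>2 \<le> norm T * norm v"
    using norm_blinfun[of T v] Tv nv by (simp add: sum_nonneg)
  then have "norm v \<le> norm T"
    by (cases "norm v = 0") (auto simp: power2_eq_square mult_le_cancel_right)
  then show ?thesis by (simp add: nv T_def)
qed

text \<open>Two candidates differ by an element of \<open>U\<close> orthogonal to both residuals,
  hence orthogonal to itself; so the definite description has a unique solution once one is
  exhibited.\<close>

lemma orth_proj_eqI:
  fixes U :: "'h::real_inner set"
  assumes "subspace U" "p \<in> U" "\<And>u. u \<in> U \<Longrightarrow> orthogonal (x - p) u"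
  shows "orth_proj U x = p"
  unfolding orth_proj_def
proof (rule the_equality)
  fix q assume q: "q \<in> U \<and> (\<forall>u\<in>U. orthogonal (x - q) u)"
  then have d: "q - p \<in> U" using assms by (simp add: subspace_diff)
  have "(q - p) \<bullet> (q - p) = (x - p) \<bullet> (q - p) - (x - q) \<bullet> (q - p)"
    by (simp add: inner_diff_left)
  also have "\<dots> = 0" using q d assms(3) by (simp add: orthogonal_def)
  finally show "q = p" by simp
qed (use assms in auto)

text \<open>Subtracting the Fourier sum \<open>?s\<close> leaves a vector orthogonal to every
  \<open>\<phi> i\<close>, while the removed part \<open>?s\<close> lies in the span.\<close>

lemma orth_proj_comp_span_orthonormal:
  fixes \<phi> :: "nat \<Rightarrow> 'h::real_inner"
  assumes fin: "finite I"
    and on: "\<And>i j. i \<in> I \<Longrightarrow> j \<in> I \<Longrightarrow> \<phi> i \<bullet> \<phi> j = (if i = j then 1 else 0)"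
  shows "orth_proj (orthogonal_comp (span (\<phi> ` I))) x = x - (\<Sum>i\<in>I. (\<phi> i \<bullet> x) *\<^sub>R \<phi> i)"
proof (rule orth_proj_eqI)
  let ?s = "\<Sum>i\<in>I. (\<phi> i \<bullet> x) *\<^sub>R \<phi> i"
  show "subspace (orthogonal_comp (span (\<phi> ` I)))" by (rule subspace_orthogonal_comp)
  have coeff: "\<phi> i \<bullet> ?s = \<phi> i \<bullet> x" if "i \<in> I" for i
  proof -
    have "\<phi> i \<bullet> ?s = (\<Sum>j\<in>I. if i = j then \<phi> j \<bullet> x else 0)"
      unfolding inner_sum_right using on that by (intro sum.cong) auto
    then show ?thesis using fin that by simp
  qed
  have "orthogonal (x - ?s) y" if "y \<in> \<phi> ` I" for y
  proof -
    from that obtain i where i: "i \<in> I" "y = \<phi> i" by blast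
    show ?thesis
      unfolding orthogonal_def i(2) inner_commute[of "x - ?s"] inner_diff_right
      using coeff[OF i(1)] by linarith
  qed
  then have "orthogonal (x - ?s) y" if "y \<in> span (\<phi> ` I)" for y
    using that orthogonal_to_span by blast
  then show "x - ?s \<in> orthogonal_comp (span (\<phi> ` I))"
    unfolding orthogonal_comp_def using orthogonal_commute by blast
  show "orthogonal (x - (x - ?s)) u" if "u \<in> orthogonal_comp (span (\<phi> ` I))" for u
  proof -
    have "?s \<in> span (\<phi> ` I)" by (intro span_sum span_scale span_base) auto
    then show ?thesis using that by (simp add: orthogonal_comp_def)
  qed
qed

section \<open>Laplace transform and characteristic functions of centred normal laws\<close>

text \<open>Merging the exponents shows that the integrand is \<open>?s\<close> times the centred
  normal density with standard deviation \<open>?s = 1 / sqrt (1 + l)\<close>.\<close>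

lemma integral_std_normal_exp_neg_square:
  assumes "l \<ge> 0"
  shows "(\<integral>x. std_normal_density x * exp (- (l * x\<^sup>2 / 2)) \<partial>lborel) = 1 / sqrt (1 + l)"
proof -
  let ?s = "1 / sqrt (1 + l)"
  have s: "0 < ?s" using assms by simp
  have "std_normal_density x * exp (- (l * x\<^sup>2 / 2)) = ?s * normal_density 0 ?s x" for x
  proof -
    have e: "- x\<^sup>2 / (2 * ?s\<^sup>2) = - x\<^sup>2 / 2 + - (l * x\<^sup>2 / 2)"
      using assms by (simp add: power_divide field_simps)
    have "?s * normal_density 0 ?s x = 1 / sqrt (2 * pi) * exp (- x\<^sup>2 / (2 * ?s\<^sup>2))"
      using assms by (simp add: normal_density_def power_divide real_sqrt_divide)
    then show ?thesis unfolding e exp_add by (simp add: std_normal_density_def)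
  qed
  then show ?thesis using integral_normal_density[OF s, of 0] by simp
qed

lemma density_normal_eq_distr:
  assumes "0 < s"
  shows "density lborel (normal_density 0 s) = distr std_normal_distribution borel (\<lambda>x. s * x)"
proof -
  interpret real_distribution std_normal_distribution by (rule real_dist_normal_dist)
  have "distributed std_normal_distribution lborel (\<lambda>x. x) std_normal_density"
    by (auto simp: distributed_def intro!: distr_id2)
  from normal_density_affine[OF this _, of s 0] assms
  have "distributed std_normal_distribution lborel (\<lambda>x. s * x) (normal_density 0 s)"
    by simp
  from distributed_distr_eq_density[OF this]
  have "density lborel (normal_density 0 s) = distr std_normal_distribution lborel (\<lambda>x. s * x)"
    by simp
  also have "\<dots> = distr std_normal_distribution borel (\<lambda>x. s * x)"
    by (rule distr_cong) auto
  finally show ?thesis .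
qed

lemma real_distribution_centred_normal: "v \<ge> 0 \<Longrightarrow> real_distribution (centred_normal v)"
  by (cases "v = 0")
    (auto simp: centred_normal_def real_distribution_def real_distribution_axioms_def
      intro!: prob_space_return prob_space_normal_density)

text \<open>The point mass and the scaled standard normal obey the same formula, so degenerate
  directions require no separate treatment later.\<close>

lemma char_centred_normal:
  assumes "v \<ge> 0"
  shows "char (centred_normal v) t = complex_of_real (exp (- (v * t\<^sup>2 / 2)))"
proof (cases "v = 0")
  case True
  then show ?thesis by (simp add: centred_normal_def char_def integral_return)
next
  case False
  then have v: "centred_normal v = distr std_normal_distribution borel (\<lambda>x. sqrt v * x)"
    using assms by (simp only: centred_normal_def if_False) (rule density_normal_eq_distr, simp)
  have "char (centred_normal v) t = char std_normal_distribution (t * sqrt v)"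
    unfolding v char_def by (subst integral_distr) (simp_all only: mult.assoc, simp_all)
  also have "\<dots> = complex_of_real (exp (- (t * sqrt v)\<^sup>2 / 2))"
    unfolding char_std_normal_distribution ..
  also have "- (t * sqrt v)\<^sup>2 / 2 = - (v * t\<^sup>2 / 2)"
    using assms by (simp add: power_mult_distrib)
  finally show ?thesis .
qed

section \<open>Consequences of weak convergence\<close>

text \<open>Weak convergence tests real functions only, whereas characteristic functions integrate
  complex ones. The claim follows from real and imaginary parts; integrability lets these commute
  with the integral.\<close>

lemma weak_conv_borel_complex:
  fixes f :: "'a::topological_space \<Rightarrow> complex"
  assumes "weak_conv_borel \<mu> \<nu>"
    and \<mu>: "\<And>n. prob_space (\<mu> n)" "\<And>n. sets (\<mu> n) = sets borel"
    and \<nu>: "prob_space \<nu>" "sets \<nu> = sets borel"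
    and cont: "continuous_on UNIV f" and bound: "\<And>x. norm (f x) \<le> B"
  shows "(\<lambda>n. \<integral>x. f x \<partial>\<mu> n) \<longlonglongrightarrow> (\<integral>x. f x \<partial>\<nu>)"
proof -
  have int: "integrable P f" if "prob_space P" "sets P = sets borel" for P
  proof -
    interpret prob_space P by fact
    have "f \<in> borel_measurable P"
      using borel_measurable_continuous_onI[OF cont] by (simp cong: measurable_cong_sets add: that)
    then show ?thesis using bound by (intro integrable_const_bound[of _ B]) auto
  qed
  have "bounded (range (\<lambda>x. Re (f x)))" "bounded (range (\<lambda>x. Im (f x)))"
    using order_trans[OF abs_Re_le_cmod bound] order_trans[OF abs_Im_le_cmod bound]
    by (auto intro!: boundedI)
  moreover have "continuous_on UNIV (\<lambda>x. Re (f x))" "continuous_on UNIV (\<lambda>x. Im (f x))"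
    using cont by (auto intro!: continuous_intros)
  ultimately have "(\<lambda>n. \<integral>x. Re (f x) \<partial>\<mu> n) \<longlonglongrightarrow> (\<integral>x. Re (f x) \<partial>\<nu>)"
    "(\<lambda>n. \<integral>x. Im (f x) \<partial>\<mu> n) \<longlonglongrightarrow> (\<integral>x. Im (f x) \<partial>\<nu>)"
    using assms(1) by (auto simp: weak_conv_borel_def)
  then show ?thesis
    using int[OF \<mu>] int[OF \<nu>] by (simp only: tendsto_complex_iff integral_Re integral_Im)
qed

text \<open>A truncated Markov inequality: \<open>min 1 (f x / \<epsilon>)\<close> dominates the
  indicator of \<open>f x \<ge> \<epsilon>\<close>, and the truncation makes it a bounded continuous
  test function.\<close>

lemma weak_conv_borel_limsup_le:
  fixes f :: "'a::topological_space \<Rightarrow> real"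
  assumes wc: "weak_conv_borel (\<lambda>n. distr (M n) borel (X n)) \<nu>"
    and M: "\<And>n. prob_space (M n)" "\<And>n. X n \<in> borel_measurable (M n)"
    and cont: "continuous_on UNIV f" and nonneg: "\<And>x. 0 \<le> f x" and "0 < \<epsilon>"
  shows "limsup (\<lambda>n. ereal (\<P>(w in M n. f (X n w) \<ge> \<epsilon>))) \<le> ereal (\<integral>x. min 1 (f x / \<epsilon>) \<partial>\<nu>)"
proof -
  let ?g = "\<lambda>x. min 1 (f x / \<epsilon>)"
  have g: "continuous_on UNIV ?g" using cont \<open>0 < \<epsilon>\<close> by (auto intro!: continuous_intros)
  have g01: "0 \<le> ?g x" "?g x \<le> 1" for x using nonneg[of x] \<open>0 < \<epsilon>\<close> by auto
  have fm: "f \<in> borel_measurable borel" and gm: "?g \<in> borel_measurable borel"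
    using cont g by (auto intro: borel_measurable_continuous_onI)
  have "(\<lambda>n. \<integral>x. ?g x \<partial>distr (M n) borel (X n)) \<longlonglongrightarrow> (\<integral>x. ?g x \<partial>\<nu>)"
    using wc g g01 unfolding weak_conv_borel_def by (auto intro!: boundedI[of _ 1])
  then have lim: "(\<lambda>n. \<integral>w. ?g (X n w) \<partial>M n) \<longlonglongrightarrow> (\<integral>x. ?g x \<partial>\<nu>)"
    using M gm by (simp add: integral_distr)
  have "\<P>(w in M n. f (X n w) \<ge> \<epsilon>) \<le> (\<integral>w. ?g (X n w) \<partial>M n)" for n
  proof -
    interpret prob_space "M n" by (rule M)
    note [measurable] = M(2)[of n] fm gm
    have int: "integrable (M n) (\<lambda>w. ?g (X n w))"
      using g01 by (intro integrable_const_bound[of _ 1]) auto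
    have "\<P>(w in M n. f (X n w) \<ge> \<epsilon>) = (\<integral>w. indicator {w \<in> space (M n). f (X n w) \<ge> \<epsilon>} w \<partial>M n)"
      by simp
    also have "\<dots> \<le> (\<integral>w. ?g (X n w) \<partial>M n)"
      using int g01 \<open>0 < \<epsilon>\<close>
      by (intro integral_mono) (auto split: split_indicator simp: less_top[symmetric])
    finally show ?thesis .
  qed
  then have "limsup (\<lambda>n. ereal (\<P>(w in M n. f (X n w) \<ge> \<epsilon>))) \<le> limsup (\<lambda>n. ereal (\<integral>w. ?g (X n w) \<partial>M n))"
    by (intro Limsup_mono) simp
  also have "\<dots> = ereal (\<integral>x. ?g x \<partial>\<nu>)"
    using lim by (intro lim_imp_Limsup) auto
  finally show ?thesis .
qed

section \<open>The Gaussian series: partial sums and measurability\<close>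

locale gaussian_series = prob_space M for M :: "'b measure" +
  fixes N :: enat and lam :: "nat \<Rightarrow> real" and \<phi> :: "nat \<Rightarrow> 'h::{real_inner,complete_space}"
    and Z :: "nat \<Rightarrow> 'b \<Rightarrow> real"
  assumes lam_pos: "\<And>i. i \<in> idx N \<Longrightarrow> lam i > 0"
    and basis: "orthonormal_basis N \<phi>"
    and indep: "indep_vars (\<lambda>_. borel) Z (idx N)"
    and normal: "\<And>i. i \<in> idx N \<Longrightarrow> distributed M lborel (Z i) std_normal_density"
    and Cauchy: "AE w in M. Cauchy (\<lambda>k. \<Sum>i<k. gauss_term N lam \<phi> Z i w)"
begin

abbreviation G :: "'b \<Rightarrow> 'h \<Rightarrow>\<^sub>L real" where
  "G \<equiv> gauss_series N lam \<phi> Z"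

definition gauss_partial :: "nat \<Rightarrow> 'b \<Rightarrow> 'h \<Rightarrow>\<^sub>L real" where
  "gauss_partial k w = (\<Sum>i<k. gauss_term N lam \<phi> Z i w)"

text \<open>Zero weights beyond the dimension let finite and infinite \<open>N\<close> share series
  over all naturals.\<close>

definition variance_weight :: "nat \<Rightarrow> real" where
  "variance_weight i = (if i \<in> idx N then lam i else 0)"

text \<open>The form of the diagonal operator with eigenvectors \<open>\<phi> i\<close> and
  eigenvalues \<open>lam i\<close>; it serves as the \<sigma> of the theorem.\<close>

definition cov :: "'h \<Rightarrow> 'h \<Rightarrow> real" where
  "cov x y = (\<Sum>i. variance_weight i * (\<phi> i \<bullet> x) * (\<phi> i \<bullet> y))"

lemma variance_weight_nonneg: "0 \<le> variance_weight i"
  using lam_pos by (simp add: variance_weight_def less_imp_le)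

lemma orthonormal: "i \<in> idx N \<Longrightarrow> j \<in> idx N \<Longrightarrow> \<phi> i \<bullet> \<phi> j = (if i = j then 1 else 0)"
  using basis by (simp add: orthonormal_basis_def)

lemma Z_measurable: "i \<in> idx N \<Longrightarrow> Z i \<in> borel_measurable M"
  using normal[of i] distributed_measurable by fastforce

lemma sum_idx:
  fixes f :: "nat \<Rightarrow> 'c::comm_monoid_add"
  shows "(\<Sum>i<k. if i \<in> idx N then f i else 0) = (\<Sum>i\<in>idx N \<inter> {..<k}. f i)"
  by (simp add: Int_commute[of "idx N"] sum.inter_restrict)

lemma gauss_partial_eq:
  "gauss_partial k w = (\<Sum>i\<in>idx N \<inter> {..<k}. (sqrt (lam i) * Z i w) *\<^sub>R blinfun_inner_right (\<phi> i))"
  unfolding gauss_partial_def gauss_term_def by (rule sum_idx)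

lemma gauss_partial_apply:
  "blinfun_apply (gauss_partial k w) h = (\<Sum>i\<in>idx N \<inter> {..<k}. sqrt (lam i) * (\<phi> i \<bullet> h) * Z i w)"
  unfolding gauss_partial_eq by (simp add: blinfun.sum_left blinfun.scaleR_left mult_ac)

text \<open>The dual space need not be second countable, so measurability of sums and differences is
  obtained by factoring through the second countable space of real sequences.\<close>

lemma measurable_continuous_seq:
  assumes "continuous_on UNIV (g :: (nat \<Rightarrow> real) \<Rightarrow> 'c::topological_space)"
    and "\<And>w. f w = g (\<lambda>i. if i \<in> idx N then Z i w else 0)"
  shows "f \<in> borel_measurable M"
proof -
  have "(\<lambda>w i. if i \<in> idx N then Z i w else 0) \<in> borel_measurable M"
  proof (rule measurable_coordinatewise_then_product)
    show "(\<lambda>w. if i \<in> idx N then Z i w else 0) \<in> borel_measurable M" for i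
      by (cases "i \<in> idx N") (simp_all add: Z_measurable)
  qed
  from measurable_compose[OF this borel_measurable_continuous_onI[OF assms(1)]]
  show ?thesis by (simp add: assms(2)[abs_def])
qed

text \<open>The partial sum as a deterministic function of the coefficient sequence; it depends on
  finitely many coordinates, hence is continuous for the product topology.\<close>

definition seq_partial :: "nat \<Rightarrow> (nat \<Rightarrow> real) \<Rightarrow> 'h \<Rightarrow>\<^sub>L real" where
  "seq_partial k x = (\<Sum>i\<in>idx N \<inter> {..<k}. (sqrt (lam i) * x i) *\<^sub>R blinfun_inner_right (\<phi> i))"

lemma continuous_seq_partial: "continuous_on UNIV (seq_partial k)"
  unfolding seq_partial_def by (intro continuous_intros continuous_on_product_coordinates)

lemma gauss_partial_seq:
  "gauss_partial k w = seq_partial k (\<lambda>i. if i \<in> idx N then Z i w else 0)"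
  unfolding gauss_partial_eq seq_partial_def by (intro sum.cong) auto

lemma gauss_partial_measurable: "gauss_partial k \<in> borel_measurable M"
  by (rule measurable_continuous_seq[OF continuous_seq_partial gauss_partial_seq])

lemma gauss_partial_dist_measurable [measurable]:
  "(\<lambda>w. dist (gauss_partial m w) (gauss_partial n w)) \<in> borel_measurable M"
proof (rule measurable_continuous_seq)
  show "continuous_on UNIV (\<lambda>x. dist (seq_partial m x) (seq_partial n x))"
    by (intro continuous_on_dist continuous_seq_partial)
qed (simp add: gauss_partial_seq)

text \<open>Completeness of the dual links the Cauchy hypothesis to the summability that
  \<open>suminf\<close> refers to.\<close>

lemma Cauchy_gauss_partial_iff:
  "Cauchy (\<lambda>k. gauss_partial k w) \<longleftrightarrow> summable (\<lambda>i. gauss_term N lam \<phi> Z i w)"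
  by (simp add: summable_iff_convergent Cauchy_convergent_iff gauss_partial_def)

lemma G_measurable [measurable]: "G \<in> borel_measurable M"
proof -
  \<comment> \<open>This is the unspecified value that \<open>suminf\<close> returns for every
    divergent series, so \<open>G\<close> is constant off \<open>?C\<close>.\<close>
  let ?c = "The (\<lambda>s :: 'h \<Rightarrow>\<^sub>L real. False)"
  let ?C = "{w \<in> space M. Cauchy (\<lambda>k. gauss_partial k w)}"
  \<comment> \<open>The Cauchy condition unfolds to countably many conditions on distances of
    partial sums.\<close>
  have [measurable]: "?C \<in> sets M"
    unfolding metric_Cauchy_iff2 by measurable
  show ?thesis
  proof (rule borel_measurable_LIMSEQ_metric)
    show "(\<lambda>w. if w \<in> ?C then gauss_partial k w else ?c) \<in> borel_measurable M" for k
      by (intro measurable_If_set gauss_partial_measurable) auto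
    show "(\<lambda>k. if w \<in> ?C then gauss_partial k w else ?c) \<longlonglongrightarrow> G w" if "w \<in> space M" for w
    proof (cases "w \<in> ?C")
      case True
      then have "summable (\<lambda>i. gauss_term N lam \<phi> Z i w)" by (simp add: Cauchy_gauss_partial_iff)
      from summable_LIMSEQ[OF this] True show ?thesis
        by (simp add: gauss_partial_def gauss_series_def)
    next
      case False
      then have "\<not> summable (\<lambda>i. gauss_term N lam \<phi> Z i w)" using that by (simp add: Cauchy_gauss_partial_iff)
      then have "G w = ?c" by (auto simp: gauss_series_def suminf_def summable_def)
      with False show ?thesis by auto
    qed
  qed
qed

lemma AE_gauss_partial_tendsto: "AE w in M. (\<lambda>k. gauss_partial k w) \<longlonglongrightarrow> G w"
  using Cauchy
proof eventually_elim
  case (elim w)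
  then have "summable (\<lambda>i. gauss_term N lam \<phi> Z i w)"
    by (simp flip: Cauchy_gauss_partial_iff add: gauss_partial_def)
  from summable_LIMSEQ[OF this] show ?case by (simp add: gauss_partial_def gauss_series_def)
qed

section \<open>Summability of the variances\<close>

definition sq_term :: "nat \<Rightarrow> 'b \<Rightarrow> real" where
  "sq_term i w = (if i \<in> idx N then lam i * (Z i w)\<^sup>2 else 0)"

lemma sq_term_measurable [measurable]: "sq_term i \<in> borel_measurable M"
  by (cases "i \<in> idx N") (auto simp: sq_term_def[abs_def] intro!: borel_measurable_times borel_measurable_power Z_measurable)

lemma sq_term_nonneg: "0 \<le> sq_term i w"
  using lam_pos by (simp add: sq_term_def less_imp_le)

text \<open>A convergent sequence of partial sums is bounded in the dual norm by some
  \<open>B\<close>, which dominates the Euclidean norm of the coefficients; so the sums of these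
  nonnegative terms stay below \<open>B\<^sup>2\<close>.\<close>

lemma AE_summable_sq: "AE w in M. summable (\<lambda>i. sq_term i w)"
  using AE_gauss_partial_tendsto
proof eventually_elim
  case (elim w)
  then have "Bseq (\<lambda>k. gauss_partial k w)" by (intro convergent_imp_Bseq) (auto simp: convergent_def)
  then obtain B where B: "\<And>k. norm (gauss_partial k w) \<le> B" unfolding Bseq_def by blast
  show ?case
  proof (rule summableI_nonneg_bounded[OF sq_term_nonneg])
    fix k
    have "(\<Sum>i<k. sq_term i w) = (\<Sum>i\<in>idx N \<inter> {..<k}. (sqrt (lam i) * Z i w)\<^sup>2)"
      unfolding sq_term_def sum_idx using lam_pos
      by (intro sum.cong) (auto simp: power_mult_distrib less_imp_le)
    moreover have "sqrt (\<Sum>i\<in>idx N \<inter> {..<k}. (sqrt (lam i) * Z i w)\<^sup>2) \<le> B"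
      using norm_orthonormal_sum_blinfun_ge[of "idx N \<inter> {..<k}" \<phi> "\<lambda>i. sqrt (lam i) * Z i w"]
        orthonormal B[of k] unfolding gauss_partial_eq by fastforce
    ultimately show "(\<Sum>i<k. sq_term i w) \<le> B\<^sup>2"
      by (simp add: sqrt_le_D)
  qed
qed

text \<open>Independence factors the expectation over the indices in \<open>idx N\<close>; the
  remaining indices contribute the factor 1.\<close>

lemma Laplace_transform_partial:
  "(\<integral>w. exp (- (\<Sum>i<k. sq_term i w) / 2) \<partial>M) = (\<Prod>i<k. 1 / sqrt (1 + variance_weight i))"
proof -
  let ?I = "idx N \<inter> {..<k}"
  let ?f = "\<lambda>i x. exp (- (lam i * x\<^sup>2 / 2))"
  have "exp (- (\<Sum>i<k. sq_term i w) / 2) = (\<Prod>i\<in>?I. ?f i (Z i w))" for w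
    unfolding sq_term_def sum_idx
    by (simp add: sum_negf[symmetric] sum_divide_distrib exp_sum)
  then have "(\<integral>w. exp (- (\<Sum>i<k. sq_term i w) / 2) \<partial>M) = (\<integral>w. (\<Prod>i\<in>?I. ?f i (Z i w)) \<partial>M)"
    by simp
  also have "\<dots> = (\<Prod>i\<in>?I. \<integral>w. ?f i (Z i w) \<partial>M)"
  proof (rule indep_vars_lebesgue_integral)
    show "indep_vars (\<lambda>_. borel) (\<lambda>i w. ?f i (Z i w)) ?I"
      by (rule indep_vars_compose2[OF indep_vars_subset[OF indep]]) auto
    show "integrable M (\<lambda>w. ?f i (Z i w))" if "i \<in> ?I" for i
      using that lam_pos[of i] Z_measurable[of i] by (intro integrable_const_bound[of _ 1]) auto
  qed auto
  also have "\<dots> = (\<Prod>i\<in>?I. 1 / sqrt (1 + variance_weight i))"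
  proof (rule prod.cong)
    fix i assume i: "i \<in> ?I"
    then have "(\<integral>w. ?f i (Z i w) \<partial>M) = (\<integral>x. std_normal_density x * ?f i x \<partial>lborel)"
      by (intro distributed_integral[symmetric] normal) auto
    with i lam_pos[of i] show "(\<integral>w. ?f i (Z i w) \<partial>M) = 1 / sqrt (1 + variance_weight i)"
      by (simp add: integral_std_normal_exp_neg_square variance_weight_def)
  qed simp
  also have "\<dots> = (\<Prod>i<k. 1 / sqrt (1 + variance_weight i))"
    by (rule prod.mono_neutral_left) (auto simp: variance_weight_def)
  finally show ?thesis .
qed

text \<open>The Laplace transforms of the partial sums decrease to that of an almost surely finite
  sum, which is not zero. Hence the products of \<open>1 + variance_weight i\<close> stay bounded,
  and they dominate the partial sums of the weights.\<close>

lemma summable_variance_weight: "summable variance_weight"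
proof -
  define u where "u w = exp (- (\<Sum>i. sq_term i w) / 2)" for w
  define \<delta> where "\<delta> = (\<integral>w. u w \<partial>M)"
  have [measurable]: "u \<in> borel_measurable M" unfolding u_def[abs_def] by measurable
  \<comment> \<open>On the divergence set the sign of \<open>suminf\<close> is unknown, so the bound
    \<open>u w \<le> 1\<close> is available only almost everywhere.\<close>
  have suminf_nonneg_AE: "AE w in M. 0 \<le> (\<Sum>i. sq_term i w)"
    using AE_summable_sq by eventually_elim (simp add: suminf_nonneg sq_term_nonneg)
  have int_u: "integrable M u"
    using suminf_nonneg_AE by (intro integrable_const_bound[of _ 1]) (auto simp: u_def)
  \<comment> \<open>A nonnegative function with zero integral vanishes almost everywhere, but an
    exponential vanishes nowhere.\<close>
  have "\<delta> \<noteq> 0"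
  proof
    assume "\<delta> = 0"
    then have "AE w in M. u w = 0"
      using integral_nonneg_eq_0_iff_AE[OF int_u] unfolding \<delta>_def by (simp add: u_def)
    then have "AE w in M. False" by (simp add: u_def)
    then show False by (simp add: AE_False)
  qed
  have "(\<lambda>k. \<integral>w. exp (- (\<Sum>i<k. sq_term i w) / 2) \<partial>M) \<longlonglongrightarrow> \<delta>"
    unfolding \<delta>_def
  proof (rule integral_dominated_convergence[where w="\<lambda>_. 1"])
    show "AE w in M. (\<lambda>k. exp (- (\<Sum>i<k. sq_term i w) / 2)) \<longlonglongrightarrow> u w"
      using AE_summable_sq unfolding u_def
      by eventually_elim (auto intro!: tendsto_intros summable_LIMSEQ)
  qed (auto simp: sum_nonneg sq_term_nonneg)
  \<comment> \<open>Squaring and inverting turns each factor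
    \<open>1 / sqrt (1 + variance_weight i)\<close> into
    \<open>1 + variance_weight i\<close>.\<close>
  then have "(\<lambda>k. 1 / (\<Prod>i<k. 1 / sqrt (1 + variance_weight i))\<^sup>2) \<longlonglongrightarrow> 1 / \<delta>\<^sup>2"
    unfolding Laplace_transform_partial using \<open>\<delta> \<noteq> 0\<close> by (intro tendsto_intros) auto
  moreover have "1 / (\<Prod>i<k. 1 / sqrt (1 + variance_weight i))\<^sup>2 = (\<Prod>i<k. 1 + variance_weight i)" for k
    using variance_weight_nonneg
    by (simp add: prod_dividef power_divide add_nonneg_nonneg prod_power_distrib)
  ultimately have "Bseq (\<lambda>k. \<Prod>i<k. 1 + variance_weight i)"
    by (intro convergent_imp_Bseq) (auto simp: convergent_def)
  then obtain B where "\<And>k. \<bar>\<Prod>i<k. 1 + variance_weight i\<bar> \<le> B"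
    unfolding Bseq_def by auto
  moreover have "(\<Sum>i<k. variance_weight i) \<le> (\<Prod>i<k. 1 + variance_weight i)" for k
    using sum_le_prod[of "{..<k}" variance_weight] variance_weight_nonneg by simp
  ultimately show ?thesis
    by (intro summableI_nonneg_bounded[of _ B] variance_weight_nonneg) (meson abs_ge_self order_trans)
qed

section \<open>The covariance form and its trace\<close>

text \<open>Cauchy-Schwarz with unit vectors \<open>\<phi> i\<close>. This domination yields both
  the convergence of the series for \<open>cov\<close> and its bound with constant
  \<open>\<Sum>i. variance_weight i\<close>.\<close>

lemma cov_term_bound:
  "norm (variance_weight i * (\<phi> i \<bullet> x) * (\<phi> i \<bullet> y)) \<le> variance_weight i * (norm x * norm y)"
proof (cases "i \<in> idx N")
  case True
  then have "norm (\<phi> i) = 1" using orthonormal[of i i] by (simp add: norm_eq_sqrt_inner)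
  then have "\<bar>\<phi> i \<bullet> x\<bar> * \<bar>\<phi> i \<bullet> y\<bar> \<le> norm x * norm y"
    using Cauchy_Schwarz_ineq2[of "\<phi> i" x] Cauchy_Schwarz_ineq2[of "\<phi> i" y]
    by (intro mult_mono) auto
  then show ?thesis
    using variance_weight_nonneg[of i] by (simp add: abs_mult mult_left_mono mult.assoc)
qed (simp add: variance_weight_def)

lemma summable_cov: "summable (\<lambda>i. variance_weight i * (\<phi> i \<bullet> x) * (\<phi> i \<bullet> y))"
  by (rule summable_comparison_test'[OF summable_mult2[OF summable_variance_weight] cov_term_bound])

lemma bounded_bilinear_cov: "bounded_bilinear cov"
proof
  fix a a' b b' :: 'h and r :: real
  show "cov (a + a') b = cov a b + cov a' b"
    unfolding cov_def suminf_add[OF summable_cov summable_cov]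
    by (simp add: inner_add_right algebra_simps)
  show "cov a (b + b') = cov a b + cov a b'"
    unfolding cov_def suminf_add[OF summable_cov summable_cov]
    by (simp add: inner_add_right algebra_simps)
  show "cov (r *\<^sub>R a) b = r *\<^sub>R cov a b"
    unfolding cov_def real_scaleR_def suminf_mult[OF summable_cov, symmetric]
    by (simp add: mult_ac)
  show "cov a (r *\<^sub>R b) = r *\<^sub>R cov a b"
    unfolding cov_def real_scaleR_def suminf_mult[OF summable_cov, symmetric]
    by (simp add: mult_ac)
  show "\<exists>K. \<forall>a b. norm (cov a b) \<le> norm a * norm b * K"
  proof (intro exI allI)
    fix x y :: 'h
    have s: "summable (\<lambda>i. variance_weight i * (norm x * norm y))"
      by (rule summable_mult2[OF summable_variance_weight])
    have "norm (cov x y) \<le> (\<Sum>i. variance_weight i * (norm x * norm y))"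
      unfolding cov_def by (rule norm_suminf_le[OF cov_term_bound s])
    then show "norm (cov x y) \<le> norm x * norm y * (\<Sum>i. variance_weight i)"
      by (simp add: suminf_mult2[OF summable_variance_weight, symmetric] mult.commute)
  qed
qed

lemma cov_nonneg: "0 \<le> cov x x"
  unfolding cov_def
  by (intro suminf_nonneg summable_cov) (simp add: mult.assoc variance_weight_nonneg)

lemma cov_basis: "i \<in> idx N \<Longrightarrow> cov (\<phi> i) (\<phi> i) = variance_weight i"
proof -
  assume i: "i \<in> idx N"
  have "cov (\<phi> i) (\<phi> i) = (\<Sum>j. if j = i then variance_weight i else 0)"
    unfolding cov_def using orthonormal i by (intro suminf_cong) (auto simp: variance_weight_def)
  then show ?thesis using sums_single[of i "\<lambda>_. variance_weight i"] by (simp add: sums_iff)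
qed

text \<open>The trace condition for the basis \<open>\<phi>\<close>: the diagonal of
  \<open>cov\<close> consists of the summable weights.\<close>

lemma cov_summable_on: "(\<lambda>i. cov (\<phi> i) (\<phi> i)) summable_on idx N"
proof -
  have "variance_weight summable_on UNIV"
    by (intro norm_summable_imp_summable_on) (simp add: summable_variance_weight variance_weight_nonneg)
  then have "variance_weight summable_on idx N" by (rule summable_on_subset_banach) simp
  then show ?thesis by (simp cong: summable_on_cong add: cov_basis)
qed

section \<open>Characteristic functions and convergence of the marginals\<close>

text \<open>For fixed \<open>h\<close> the partial sum is a sum of independent scaled normals, so
  characteristic functions multiply and exponents add; indices outside \<open>idx N\<close>
  contribute the factor 1.\<close>

lemma char_gauss_partial:
  "(CLINT w|M. iexp (t * gauss_partial k w h)) =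
     exp (- (\<Sum>i<k. variance_weight i * (\<phi> i \<bullet> h) * (\<phi> i \<bullet> h)) * t\<^sup>2 / 2)"
proof -
  let ?I = "idx N \<inter> {..<k}"
  let ?X = "\<lambda>i w. sqrt (lam i) * (\<phi> i \<bullet> h) * Z i w"
  have X: "?X i \<in> borel_measurable M" if "i \<in> idx N" for i
    using that by (intro borel_measurable_times borel_measurable_const Z_measurable)
  have charX: "char (distr M borel (?X i)) t =
      exp (- (variance_weight i * (\<phi> i \<bullet> h) * (\<phi> i \<bullet> h)) * t\<^sup>2 / 2)" if "i \<in> idx N" for i
  proof -
    have "char (distr M borel (?X i)) t = char (distr M lborel (Z i)) (t * (sqrt (lam i) * (\<phi> i \<bullet> h)))"
      unfolding char_def using that X Z_measurable by (simp add: integral_distr mult.assoc)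
    also have "distr M lborel (Z i) = std_normal_distribution"
      using normal[OF that] by (rule distributed_distr_eq_density)
    finally show ?thesis
      using that lam_pos[OF that]
      by (simp add: char_std_normal_distribution power_mult_distrib variance_weight_def power2_eq_square mult_ac)
  qed
  have "(CLINT w|M. iexp (t * gauss_partial k w h)) = char (distr M borel (\<lambda>w. \<Sum>i\<in>?I. ?X i w)) t"
    unfolding gauss_partial_apply char_def using X by (subst integral_distr) auto
  also have "\<dots> = (\<Prod>i\<in>?I. char (distr M borel (?X i)) t)"
    by (intro char_distr_sum indep_vars_compose2[OF indep_vars_subset[OF indep]]) auto
  also have "\<dots> = (\<Prod>i\<in>?I. complex_of_real (exp (- (variance_weight i * (\<phi> i \<bullet> h) * (\<phi> i \<bullet> h)) * t\<^sup>2 / 2)))"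
    by (intro prod.cong) (auto simp only: charX Int_iff)
  also have "\<dots> = (\<Prod>i<k. complex_of_real (exp (- (variance_weight i * (\<phi> i \<bullet> h) * (\<phi> i \<bullet> h)) * t\<^sup>2 / 2)))"
    by (rule prod.mono_neutral_left) (auto simp: variance_weight_def)
  also have "\<dots> = exp (- (\<Sum>i<k. variance_weight i * (\<phi> i \<bullet> h) * (\<phi> i \<bullet> h)) * t\<^sup>2 / 2)"
    by (simp only: of_real_prod[symmetric] exp_sum[symmetric, OF finite_lessThan]
        sum_divide_distrib sum_distrib_right sum_negf[symmetric])
  finally show ?thesis .
qed

text \<open>The characteristic functions of the partial sums have two limits that must agree: one by
  dominated convergence, as the integrands have modulus 1, the other by convergence of the series
  \<open>cov h h\<close> in the exponent.\<close>

lemma char_G: "(CLINT w|M. iexp (t * G w h)) = exp (- (cov h h * t\<^sup>2 / 2))"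
proof (rule LIMSEQ_unique)
  have [measurable]: "(\<lambda>w. gauss_partial k w h) \<in> borel_measurable M" for k
    by (rule measurable_compose[OF gauss_partial_measurable])
      (intro borel_measurable_continuous_onI continuous_intros)
  have [measurable]: "(\<lambda>w. G w h) \<in> borel_measurable M"
    by (rule measurable_compose[OF G_measurable])
      (intro borel_measurable_continuous_onI continuous_intros)
  show "(\<lambda>k. CLINT w|M. iexp (t * gauss_partial k w h)) \<longlonglongrightarrow> (CLINT w|M. iexp (t * G w h))"
  proof (rule integral_dominated_convergence[where w="\<lambda>_. 1"])
    show "AE w in M. (\<lambda>k. iexp (t * gauss_partial k w h)) \<longlonglongrightarrow> iexp (t * G w h)"
      using AE_gauss_partial_tendsto by eventually_elim (intro tendsto_intros)
  qed auto
  show "(\<lambda>k. CLINT w|M. iexp (t * gauss_partial k w h)) \<longlonglongrightarrow> complex_of_real (exp (- (cov h h * t\<^sup>2 / 2)))"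
    unfolding char_gauss_partial cov_def
    using summable_LIMSEQ[OF summable_cov[of h h]]
    by (auto intro!: tendsto_eq_intros)
qed

text \<open>Evaluation at \<open>h\<close> is continuous on the dual, so
  \<open>iexp (t * T h)\<close> is a bounded continuous test function of \<open>T\<close>; its
  integrals are the characteristic functions required by Levy's theorem.\<close>

lemma weak_conv_m_apply:
  fixes S :: "nat \<Rightarrow> 'a \<Rightarrow> 'h \<Rightarrow>\<^sub>L real"
  assumes P: "\<And>n. prob_space (P n)" and S: "\<And>n. S n \<in> borel_measurable (P n)"
    and wc: "weak_conv_borel (\<lambda>n. distr (P n) borel (S n)) (distr M borel G)"
  shows "weak_conv_m (\<lambda>n. distr (P n) borel (\<lambda>w. S n w h)) (centred_normal (cov h h))"
proof (rule levy_continuity)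
  have app: "(\<lambda>T :: 'h \<Rightarrow>\<^sub>L real. T h) \<in> borel_measurable borel"
    by (intro borel_measurable_continuous_onI continuous_intros)
  have Sh: "(\<lambda>w. S n w h) \<in> borel_measurable (P n)" for n
    by (rule measurable_compose[OF S app])
  show "real_distribution (distr (P n) borel (\<lambda>w. S n w h))" for n
    using prob_space.real_distribution_distr[OF P Sh] .
  show "real_distribution (centred_normal (cov h h))"
    by (rule real_distribution_centred_normal[OF cov_nonneg])
  fix t
  let ?e = "\<lambda>T :: 'h \<Rightarrow>\<^sub>L real. iexp (t * T h)"
  have e: "continuous_on UNIV ?e" by (intro continuous_intros)
  have em: "?e \<in> borel_measurable borel" by (rule borel_measurable_continuous_onI[OF e])
  have "(\<lambda>n. CLINT T|distr (P n) borel (S n). ?e T) \<longlonglongrightarrow> (CLINT T|distr M borel G. ?e T)"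
    using wc
  proof (rule weak_conv_borel_complex)
    show "norm (?e T) \<le> 1" for T by simp
    show "continuous_on UNIV ?e" by (rule e)
  qed (auto intro!: prob_space.prob_space_distr P S G_measurable prob_space_axioms)
  then have "(\<lambda>n. CLINT w|P n. ?e (S n w)) \<longlonglongrightarrow> (CLINT w|M. ?e (G w))"
    using em S by (simp add: integral_distr)
  moreover have "(CLINT w|P n. ?e (S n w)) = char (distr (P n) borel (\<lambda>w. S n w h)) t" for n
    unfolding char_def using Sh by (subst integral_distr) auto
  moreover have "(CLINT w|M. ?e (G w)) = char (centred_normal (cov h h)) t"
    by (simp only: char_G char_centred_normal[OF cov_nonneg])
  ultimately show "(\<lambda>n. char (distr (P n) borel (\<lambda>w. S n w h)) t) \<longlonglongrightarrow> char (centred_normal (cov h h)) t"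
    by simp
qed

section \<open>Tails of the functionals under projection\<close>

text \<open>The projection onto the orthogonal complement of the first \<open>k\<close> basis
  vectors, given as a bounded operator so that composition with it is continuous in the
  functional.\<close>

definition tail_proj :: "nat \<Rightarrow> 'h \<Rightarrow>\<^sub>L 'h" where
  "tail_proj k = id_blinfun - (\<Sum>i\<in>idx N \<inter> {..<k}. blinfun_scaleR_left (\<phi> i) o\<^sub>L blinfun_inner_right (\<phi> i))"

lemma tail_proj_apply: "tail_proj k x = x - (\<Sum>i\<in>idx N \<inter> {..<k}. (\<phi> i \<bullet> x) *\<^sub>R \<phi> i)"
  by (simp add: tail_proj_def blinfun.diff_left blinfun.sum_left)

lemma orth_proj_initial_span: "orth_proj (orthogonal_comp (initial_span N \<phi> k)) = tail_proj k"
  unfolding initial_span_def fun_eq_iff tail_proj_apply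
  by (intro allI orth_proj_comp_span_orthonormal orthonormal) auto

text \<open>As \<open>k \<le> m\<close>, the first \<open>k\<close> basis vectors all occur in the
  \<open>m\<close>-th partial sum, so its value on the removed Fourier sum is exactly the
  \<open>k\<close>-th partial sum.\<close>

lemma gauss_partial_tail_proj:
  assumes "k \<le> m"
  shows "gauss_partial m w o\<^sub>L tail_proj k = gauss_partial m w - gauss_partial k w"
proof (rule blinfun_eqI)
  fix x
  have "gauss_partial m w (\<phi> i) = sqrt (lam i) * Z i w" if i: "i \<in> idx N \<inter> {..<k}" for i
  proof -
    have "gauss_partial m w (\<phi> i) = (\<Sum>j\<in>idx N \<inter> {..<m}. if j = i then sqrt (lam i) * Z i w else 0)"
      unfolding gauss_partial_apply using i orthonormal by (intro sum.cong) auto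
    then show ?thesis using i assms by simp
  qed
  then have "gauss_partial m w (\<Sum>i\<in>idx N \<inter> {..<k}. (\<phi> i \<bullet> x) *\<^sub>R \<phi> i) = gauss_partial k w x"
    unfolding gauss_partial_apply[of k]
    by (simp add: blinfun.sum_right blinfun.scaleR_right mult_ac)
  then show "(gauss_partial m w o\<^sub>L tail_proj k) x = (gauss_partial m w - gauss_partial k w) x"
    by (simp add: tail_proj_apply blinfun.diff_right blinfun.diff_left)
qed

text \<open>First \<open>m\<close> tends to infinity in the identity for partial sums with
  \<open>k\<close> fixed, which identifies the tail as \<open>G w - gauss_partial k w\<close>; then
  \<open>k\<close> tends to infinity.\<close>

lemma AE_G_tail_tendsto: "AE w in M. (\<lambda>k. norm (G w o\<^sub>L tail_proj k)) \<longlonglongrightarrow> 0"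
  using AE_gauss_partial_tendsto
proof eventually_elim
  case (elim w)
  have "G w o\<^sub>L tail_proj k = G w - gauss_partial k w" for k
  proof (rule LIMSEQ_unique)
    show "(\<lambda>m. gauss_partial m w o\<^sub>L tail_proj k) \<longlonglongrightarrow> (G w o\<^sub>L tail_proj k)"
      using elim by (intro bounded_linear.tendsto[OF bounded_bilinear.bounded_linear_left[OF bounded_bilinear_blinfun_compose]])
    have "(\<lambda>m. gauss_partial m w - gauss_partial k w) \<longlonglongrightarrow> G w - gauss_partial k w"
      using elim by (intro tendsto_intros)
    then show "(\<lambda>m. gauss_partial m w o\<^sub>L tail_proj k) \<longlonglongrightarrow> G w - gauss_partial k w"
      by (rule Lim_transform_eventually)
        (use eventually_ge_at_top[of k] in eventually_elim, simp add: gauss_partial_tail_proj)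
  qed
  moreover have "(\<lambda>k. norm (G w - gauss_partial k w)) \<longlonglongrightarrow> norm (G w - G w)"
    using elim by (intro tendsto_intros)
  ultimately show ?case by simp
qed

text \<open>For fixed \<open>k\<close> the limit in \<open>n\<close> is bounded by the expectation
  of \<open>?g k\<close> under the law of \<open>G\<close>; since \<open>?g k\<close> takes values
  in the unit interval, dominated convergence sends this to 0 as \<open>k\<close> grows.\<close>

lemma limsup_tail_tendsto:
  fixes S :: "nat \<Rightarrow> 'a \<Rightarrow> 'h \<Rightarrow>\<^sub>L real"
  assumes P: "\<And>n. prob_space (P n)" and S: "\<And>n. S n \<in> borel_measurable (P n)"
    and wc: "weak_conv_borel (\<lambda>n. distr (P n) borel (S n)) (distr M borel G)" and "0 < \<epsilon>"
  shows "(\<lambda>k. limsup (\<lambda>n. ereal (\<P>(w in P n. (norm (S n w o\<^sub>L tail_proj k))\<^sup>2 \<ge> \<epsilon>)))) \<longlonglongrightarrow> 0"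
proof -
  let ?F = "\<lambda>k T. (norm (T o\<^sub>L tail_proj k))\<^sup>2"
  let ?g = "\<lambda>k T. min 1 (?F k T / \<epsilon>)"
  have F: "continuous_on UNIV (?F k)" for k
    by (intro continuous_intros bounded_bilinear.continuous_on[OF bounded_bilinear_blinfun_compose])
  have gm: "?g k \<in> borel_measurable borel" for k
    using F[of k] \<open>0 < \<epsilon>\<close> by (intro borel_measurable_continuous_onI continuous_intros) auto
  have "(\<lambda>k. \<integral>w. ?g k (G w) \<partial>M) \<longlonglongrightarrow> (\<integral>w. 0 \<partial>M)"
  proof (rule integral_dominated_convergence[where w="\<lambda>_. 1"])
    show "(\<lambda>w. ?g k (G w)) \<in> borel_measurable M" for k
      by (rule measurable_compose[OF G_measurable gm])
    show "AE w in M. (\<lambda>k. ?g k (G w)) \<longlonglongrightarrow> 0"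
      using AE_G_tail_tendsto
    proof eventually_elim
      case (elim w)
      then have "(\<lambda>k. ?g k (G w)) \<longlonglongrightarrow> min 1 (0\<^sup>2 / \<epsilon>)"
        using \<open>0 < \<epsilon>\<close> by (intro tendsto_intros) auto
      then show ?case by simp
    qed
  qed (use \<open>0 < \<epsilon>\<close> in auto)
  then have lim: "(\<lambda>k. ereal (\<integral>w. ?g k (G w) \<partial>M)) \<longlonglongrightarrow> 0"
    by (simp add: zero_ereal_def)
  show ?thesis
  proof (rule tendsto_sandwich[OF _ _ tendsto_const lim])
    show "\<forall>\<^sub>F k in sequentially. 0 \<le> limsup (\<lambda>n. ereal (\<P>(w in P n. ?F k (S n w) \<ge> \<epsilon>)))"
      by (intro always_eventually allI le_Limsup) auto
    have "limsup (\<lambda>n. ereal (\<P>(w in P n. ?F k (S n w) \<ge> \<epsilon>))) \<le> ereal (\<integral>T. ?g k T \<partial>distr M borel G)" for k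
      by (rule weak_conv_borel_limsup_le[OF wc P S F _ \<open>0 < \<epsilon>\<close>]) simp
    then show "\<forall>\<^sub>F k in sequentially. limsup (\<lambda>n. ereal (\<P>(w in P n. ?F k (S n w) \<ge> \<epsilon>))) \<le> ereal (\<integral>w. ?g k (G w) \<partial>M)"
      by (simp add: integral_distr[OF G_measurable gm])
  qed
qed

end

section \<open>Assembly of the three conditions\<close>

theorem theorem2:
  fixes evl :: "'h::{real_inner,complete_space} \<Rightarrow> 'x \<Rightarrow> real"
    and M :: "nat \<Rightarrow> 'a measure"
    and S :: "nat \<Rightarrow> 'a \<Rightarrow> 'h \<Rightarrow>\<^sub>L real"
    and M' :: "'b measure"
    and N :: enat
    and lam :: "nat \<Rightarrow> real"
    and \<phi> :: "nat \<Rightarrow> 'h"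
    and Z :: "nat \<Rightarrow> 'b \<Rightarrow> real"
  assumes "rkhs evl"
    and "separable_space (euclidean :: 'h topology)"
    and "\<And>n. prob_space (M n)"
    and "\<And>n. S n \<in> borel_measurable (M n)"
    and "prob_space M'"
    and "\<And>i. i \<in> idx N \<Longrightarrow> lam i > 0"
    and "orthonormal_basis N \<phi>"
    and "prob_space.indep_vars M' (\<lambda>_. borel) Z (idx N)"
    and "\<And>i. i \<in> idx N \<Longrightarrow> distributed M' lborel (Z i) std_normal_density"
    and "AE w in M'. Cauchy (\<lambda>k. \<Sum>i<k. gauss_term N lam \<phi> Z i w)"
    and "weak_conv_borel (\<lambda>n. distr (M n) borel (S n)) (distr M' borel (gauss_series N lam \<phi> Z))"
  shows "(\<exists>\<sigma> :: 'h \<Rightarrow> 'h \<Rightarrow> real.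
            bilinear \<sigma> \<and> continuous_on UNIV (\<lambda>(x, y). \<sigma> x y) \<and>
            (\<forall>(m::nat) (\<omega> :: nat \<Rightarrow> 'h).
               0 \<le> (\<Sum>i=1..m. \<Sum>j=1..m. \<sigma> (\<omega> i) (\<omega> j)) \<and>
               weak_conv_m (\<lambda>n. distr (M n) borel (\<lambda>w. S n w (\<Sum>i=1..m. \<omega> i)))
                 (centred_normal (\<Sum>i=1..m. \<Sum>j=1..m. \<sigma> (\<omega> i) (\<omega> j)))) \<and>
            (\<exists>\<psi>. orthonormal_basis N \<psi> \<and> (\<lambda>i. \<sigma> (\<psi> i) (\<psi> i)) summable_on idx N)) \<and>
         (\<exists>\<psi>. orthonormal_basis N \<psi> \<and>
            (\<forall>\<epsilon>>0.
               (\<lambda>i. limsup (\<lambda>n. ereal (\<P>(w in M n.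
                  (onorm (\<lambda>x. S n w (orth_proj (orthogonal_comp (initial_span N \<psi> i)) x)))\<^sup>2 \<ge> \<epsilon>))))
               \<longlonglongrightarrow> 0))"
proof -
  interpret gaussian_series M' N lam \<phi> Z
    using assms(5-10) by (simp add: gaussian_series_def gaussian_series_axioms_def)
  interpret cov: bounded_bilinear cov by (rule bounded_bilinear_cov)
  have "bilinear cov"
    by (simp add: bilinear_def cov.bounded_linear_left cov.bounded_linear_right bounded_linear.linear)
  moreover have "continuous_on UNIV (\<lambda>(x, y). cov x y)"
    unfolding case_prod_beta by (intro cov.continuous_on continuous_intros)
  \<comment> \<open>Bilinearity collapses the double sum to a single value on the diagonal, so
    nonnegativity and the limit law both reduce to the one vector
    \<open>\<Sum>i=1..m. \<omega> i\<close>.\<close>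
  moreover have "(\<Sum>i=1..m. \<Sum>j=1..m. cov (\<omega> i) (\<omega> j)) = cov (\<Sum>i=1..m. \<omega> i) (\<Sum>i=1..m. \<omega> i)"
    for m :: nat and \<omega>
    unfolding cov.sum_left cov.sum_right by (rule sum.swap)
  \<comment> \<open>The dual norm is by definition the \<open>onorm\<close> of the underlying
    function, so the projected functional may be treated as a composition of bounded
    operators.\<close>
  moreover have "(onorm (\<lambda>x. S n w (orth_proj (orthogonal_comp (initial_span N \<phi> i)) x)))\<^sup>2 =
      (norm (S n w o\<^sub>L tail_proj i))\<^sup>2" for n w i
    by (simp add: orth_proj_initial_span norm_blinfun.rep_eq blinfun_compose.rep_eq o_def)
  \<comment> \<open>The witnesses are \<open>cov\<close> for \<sigma> and the given basis
    \<open>\<phi>\<close> for both existentially quantified bases.\<close>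
  ultimately show ?thesis
    using cov_nonneg cov_summable_on basis weak_conv_m_apply[OF assms(3,4,11)]
      limsup_tail_tendsto[OF assms(3,4,11)]
    by (intro conjI exI[of _ cov] exI[of _ \<phi>]) (simp_all only: simp_thms, auto)
qed

end
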